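(* Let $d\ge 2$ and let $\Theta\subseteq\mathbb{T}$ be non-empty and countable (finite or countably infinite). Then $$\mathcal{N}(\mathbb{C}^d,\Theta)=\begin{cases} d, & |\Theta|=1,\\ 2d-1, & |\Theta|=2,\\ 2d, & |\Theta|\ge 3.\end{cases}$$
   Context: $\mathbb{T}=\{z\in\mathbb{C}:|z|=1\}$. $\mathbb{C}^d$ carries its standard inner product, linear in the first and conjugate linear in the second argument. For $\Theta\subseteq\mathbb{T}$, $\mathbf{G}\subseteq\mathbb{C}^d$ does $\Theta$-PR (in $\mathbb{C}^d$) if for all $f,h\in\mathbb{C}^d$ the following holds: if for every $g\in\mathbf{G}$ there exists $\theta_g\in\Theta$ with $\langle f,g\rangle=\theta_g\langle h,g\rangle$, then $f=\theta h$ for some $\theta\in\Theta$. $$\mathcal{N}(\mathbb{C}^d,\Theta)=\min\{m\in\mathbb{N}:\ \exists\,\mathbf{G}\subseteq\mathbb{C}^d\text{ with }|\mathbf{G}|=m\text{ that does }\Theta\text{-PR in }\mathbb{C}^d\}.$$ *)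

theory Defs
  imports "HOL-Analysis.Analysis"
begin

text \<open>The library's inner product on \<^typ>\<open>complex ^ 'd\<close> is the real one, hence this definition.\<close>

definition cinner :: "complex ^ 'd \<Rightarrow> complex ^ 'd \<Rightarrow> complex" where
  "cinner f g = (\<Sum>i\<in>UNIV. f $ i * cnj (g $ i))"

definition does_PR :: "complex set \<Rightarrow> (complex ^ 'd) set \<Rightarrow> bool" where
  "does_PR \<Theta> G \<longleftrightarrow>
     (\<forall>f h. (\<forall>g\<in>G. \<exists>\<theta>\<in>\<Theta>. cinner f g = \<theta> * cinner h g) \<longrightarrow> (\<exists>\<theta>\<in>\<Theta>. f = \<theta> *s h))"

definition PR_sizes :: "'d::finite itself \<Rightarrow> complex set \<Rightarrow> nat set" where
  "PR_sizes _ \<Theta> = {m. \<exists>G :: (complex ^ 'd) set. finite G \<and> card G = m \<and> does_PR \<Theta> G}"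

text \<open>
  The minimum of \<^const>\<open>PR_sizes\<close>. If no finite set does \<open>\<Theta>\<close>-PR, the value is 0; otherwise it is
  positive, because the empty set never does \<open>\<Theta>\<close>-PR for \<open>\<Theta>\<close> in the unit circle. An equation
  with a positive right-hand side therefore includes the claim that the minimum exists.
\<close>

definition PR_number :: "'d::finite itself \<Rightarrow> complex set \<Rightarrow> nat" where
  "PR_number d \<Theta> = (if PR_sizes d \<Theta> = {} then 0 else (LEAST m. m \<in> PR_sizes d \<Theta>))"

end

theory Submission
  imports Defs
begin

text \<open>
  The hypothesis \<open>\<langle>f, g\<rangle> = \<theta>\<^sub>g \<langle>h, g\<rangle>\<close> says that \<open>g\<close> is orthogonal to \<open>f - \<theta>\<^sub>g h\<close>.

  Lower bounds: two vectors \<open>u\<close>, \<open>v\<close> orthogonal to two parts of \<open>G\<close> of size at most \<open>d - 1\<close>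
  determine \<open>f\<close>, \<open>h\<close> with \<open>f - \<theta>\<^sub>1 h\<close>, \<open>f - \<theta>\<^sub>2 h\<close> proportional to \<open>u\<close>, \<open>v\<close>. Then
  \<open>f - \<theta>\<^sub>3 h\<close> is a combination of \<open>u\<close> and \<open>v\<close>, and rescaling \<open>u\<close> and \<open>v\<close> makes it orthogonal
  to one more element of \<open>G\<close>.

  Upper bounds: for finite \<open>\<Theta>\<close>, a pigeonhole argument with vectors on the moment curve, of which
  a hyperplane contains at most \<open>d - 1\<close>. For countable \<open>\<Theta>\<close>, vectors are chosen one at a time:
  each assignment of phases to the vectors already chosen leaves a subspace of pairs \<open>(f, h)\<close>,
  and unless \<open>f = \<theta> h\<close> on that subspace, a generic next vector cuts its dimension,
  simultaneously for all of the countably many assignments. The dimension is \<open>2 d\<close> initially.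
\<close>

subsection \<open>The inner product\<close>

lemma cinner_add_left: "cinner (x + y) g = cinner x g + cinner y g"
  by (simp add: cinner_def distrib_right sum.distrib)

lemma cinner_diff_left: "cinner (x - y) g = cinner x g - cinner y g"
  by (simp add: cinner_def left_diff_distrib sum_subtractf)

lemma cinner_scale_left: "cinner (c *s x) g = c * cinner x g"
  by (simp add: cinner_def sum_distrib_left mult.assoc)

lemma cinner_zero_left [simp]: "cinner 0 g = 0"
  by (simp add: cinner_def)

lemma cinner_add_right: "cinner u (x + y) = cinner u x + cinner u y"
  by (simp add: cinner_def distrib_left sum.distrib)

lemma cinner_scale_right: "cinner u (c *s x) = cnj c * cinner u x"
  by (simp add: cinner_def sum_distrib_left algebra_simps)

lemma cinner_zero_right [simp]: "cinner u 0 = 0"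
  by (simp add: cinner_def)

lemma Re_cinner: "Re (cinner u g) = inner u g"
  by (simp add: cinner_def inner_vec_def inner_complex_def)

lemma cinner_eq_iff:
  "cinner f g = \<theta> * cinner h g \<longleftrightarrow> cinner (f - \<theta> *s h) g = 0"
  by (simp add: cinner_diff_left cinner_scale_left)

lemma cinner_span_eq_0:
  assumes "x \<in> vec.span B" "\<And>b. b \<in> B \<Longrightarrow> cinner u b = 0"
  shows "cinner u x = 0"
  using assms(1)
  by (induction rule: vec.span_induct_alt)
    (use assms(2) in \<open>simp_all add: cinner_add_right cinner_scale_right\<close>)

text \<open>Real orthogonality to \<open>g\<close> and to \<open>\<i> *s g\<close> kills the real
  and the imaginary part of \<open>cinner u g\<close>. These are at most \<open>2 * card G\<close>
  real conditions in real dimension \<open>2 * CARD('d)\<close>.\<close>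

lemma exists_nonzero_cinner_orthogonal:
  fixes G :: "(complex ^ 'd) set"
  assumes "finite G" "card G < CARD('d)"
  obtains u where "u \<noteq> 0" "\<And>g. g \<in> G \<Longrightarrow> cinner u g = 0"
proof -
  let ?S = "G \<union> (\<lambda>g. \<i> *s g) ` G"
  have "dim ?S \<le> card ?S"
    using assms(1) by (intro dim_le_card') simp
  also have "\<dots> \<le> card G + card G"
    using card_Un_le card_image_le[OF assms(1)] by (meson add_left_mono le_trans)
  also have "\<dots> < DIM(complex ^ 'd)"
    using assms(2) by simp
  finally obtain u where u: "u \<noteq> 0" "\<And>y. y \<in> span ?S \<Longrightarrow> orthogonal u y"
    using orthogonal_to_subspace_exists by blast
  have "cinner u g = 0" if "g \<in> G" for g
  proof (rule complex_eqI)
    have "orthogonal u g" "orthogonal u (\<i> *s g)"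
      using u(2) that by (auto intro: span_base)
    then have "Re (cinner u g) = 0" "Re (cinner u (\<i> *s g)) = 0"
      by (simp_all add: orthogonal_def Re_cinner)
    then show "Re (cinner u g) = Re 0" "Im (cinner u g) = Im 0"
      by (simp_all add: cinner_scale_right)
  qed
  with u(1) show ?thesis
    by (rule that)
qed

subsection \<open>Lower bounds\<close>

lemma does_PR_D:
  assumes "does_PR \<Theta> G" "\<And>g. g \<in> G \<Longrightarrow> \<exists>\<theta>\<in>\<Theta>. cinner (f - \<theta> *s h) g = 0"
  obtains \<theta> where "\<theta> \<in> \<Theta>" "f - \<theta> *s h = 0"
proof -
  have "\<forall>g\<in>G. \<exists>\<theta>\<in>\<Theta>. cinner f g = \<theta> * cinner h g"
    using assms(2) by (simp add: cinner_eq_iff)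
  then obtain \<theta> where "\<theta> \<in> \<Theta>" "f = \<theta> *s h"
    using assms(1) unfolding does_PR_def by blast
  then show ?thesis
    by (intro that) auto
qed

text \<open>The pair \<open>(u, 0)\<close> meets the hypothesis of \<open>\<Theta>\<close>-PR with
  any phase.\<close>

lemma does_PR_separating:
  assumes "does_PR \<Theta> G" "\<Theta> \<noteq> {}" "\<And>g. g \<in> G \<Longrightarrow> cinner u g = 0"
  shows "u = 0"
proof -
  have "\<exists>\<theta>\<in>\<Theta>. cinner (u - \<theta> *s 0) g = 0" if "g \<in> G" for g
    using assms(2,3) that by auto
  then obtain \<theta> where "u - \<theta> *s 0 = 0"
    by (rule does_PR_D[OF assms(1)])
  then show ?thesis
    by simp
qed

lemma does_PR_card_ge:
  fixes G :: "(complex ^ 'd) set"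
  assumes "finite G" "does_PR \<Theta> G" "\<Theta> \<noteq> {}"
  shows "CARD('d) \<le> card G"
proof (rule ccontr)
  assume "\<not> ?thesis"
  then have "card G < CARD('d)"
    by simp
  then obtain u where "u \<noteq> 0" "\<And>g. g \<in> G \<Longrightarrow> cinner u g = 0"
    using assms(1) exists_nonzero_cinner_orthogonal by blast
  then show False
    using does_PR_separating[OF assms(2,3)] by blast
qed

lemma split_card_le:
  assumes "finite H" "card H \<le> m + n"
  obtains A B where "H = A \<union> B" "finite A" "finite B" "card A \<le> m" "card B \<le> n"
proof -
  obtain A where A: "A \<subseteq> H" "card A = min (card H) m" "finite A"
    using obtain_subset_with_card_n[of "min (card H) m" H] by auto
  have "card (H - A) \<le> n"
    using A assms by (simp add: card_Diff_subset)
  with A assms(1) show ?thesis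
    by (intro that[of A "H - A"]) auto
qed

lemma exists_orthogonal_pair:
  fixes H :: "(complex ^ 'd) set"
  assumes "finite H" "card H \<le> 2 * CARD('d) - 2"
  obtains u v where "u \<noteq> 0" "v \<noteq> 0" "\<And>g. g \<in> H \<Longrightarrow> cinner u g = 0 \<or> cinner v g = 0"
proof -
  have pos: "0 < CARD('d)"
    by simp
  have "card H \<le> (CARD('d) - 1) + (CARD('d) - 1)"
    using assms(2) by simp
  then obtain A B where AB: "H = A \<union> B" "finite A" "finite B"
      "card A \<le> CARD('d) - 1" "card B \<le> CARD('d) - 1"
    using assms(1) split_card_le by blast
  have "card A < CARD('d)" "card B < CARD('d)"
    using AB(4,5) pos by linarith+
  obtain u where u: "u \<noteq> 0" "\<And>g. g \<in> A \<Longrightarrow> cinner u g = 0"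
    using exists_nonzero_cinner_orthogonal[OF AB(2) \<open>card A < CARD('d)\<close>] by blast
  obtain v where v: "v \<noteq> 0" "\<And>g. g \<in> B \<Longrightarrow> cinner v g = 0"
    using exists_nonzero_cinner_orthogonal[OF AB(3) \<open>card B < CARD('d)\<close>] by blast
  show ?thesis
    using u v AB(1) by (intro that[of u v]) auto
qed

text \<open>For \<open>h = u - v\<close> and \<open>f = b u - a v\<close>, the vectors \<open>f - a h\<close> and \<open>f - b h\<close> are multiples of
  \<open>u\<close> and \<open>v\<close>.\<close>

lemma pencil_combination:
  fixes u v :: "'a::comm_ring_1 ^ 'd"
  shows "(b *s u - a *s v) - t *s (u - v) = (b - t) *s u - (a - t) *s v"
  by (simp add: vec_eq_iff algebra_simps)

lemma does_PR_doubleton_card_ge: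
  fixes G :: "(complex ^ 'd) set"
  assumes "finite G" "does_PR {a, b} G" "a \<noteq> b"
  shows "2 * CARD('d) - 1 \<le> card G"
proof (rule ccontr)
  assume "\<not> ?thesis"
  then have "card G \<le> 2 * CARD('d) - 2"
    by linarith
  then obtain u v where uv: "u \<noteq> 0" "v \<noteq> 0" "\<And>g. g \<in> G \<Longrightarrow> cinner u g = 0 \<or> cinner v g = 0"
    using assms(1) exists_orthogonal_pair by blast
  let ?f = "b *s u - a *s v" and ?h = "u - v"
  have "\<exists>\<theta>\<in>{a, b}. cinner (?f - \<theta> *s ?h) g = 0" if "g \<in> G" for g
    using uv(3)[OF that] unfolding pencil_combination
    by (auto simp: cinner_diff_left cinner_scale_left)
  then obtain \<theta> where "\<theta> \<in> {a, b}" "?f - \<theta> *s ?h = 0"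
    by (rule does_PR_D[OF assms(2)])
  then show False
    using uv(1,2) assms(3) unfolding pencil_combination by auto
qed

lemma does_PR_three_card_ge:
  fixes G :: "(complex ^ 'd) set"
  assumes G: "finite G" "does_PR \<Theta> G" and d: "2 \<le> CARD('d)"
    and \<Theta>: "a \<in> \<Theta>" "b \<in> \<Theta>" "c \<in> \<Theta>" "a \<noteq> b" "a \<noteq> c" "b \<noteq> c"
  shows "2 * CARD('d) \<le> card G"
proof (rule ccontr)
  assume "\<not> ?thesis"
  then have cardG: "card G \<le> 2 * CARD('d) - 1"
    by linarith
  \<comment> \<open>A set \<open>H\<close> with \<open>B \<subseteq> H\<close> still separates
    vectors. As \<open>CARD('d) \<ge> 2\<close>, the basis fits into the
    \<open>2 * CARD('d) - 2\<close> elements that two phases can handle; at most one element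
    \<open>g0\<close> of \<open>G\<close> is left over.\<close>
  obtain B where B: "B \<subseteq> G" "vec.independent B" "G \<subseteq> vec.span B"
    using vec.maximal_independent_subset by blast
  have "card B \<le> CARD('d)"
    using vec.independent_card_le_dim[OF subset_refl B(2)] dim_subset_UNIV_cart_gen
    by (rule order_trans)
  then have "card B \<le> 2 * CARD('d) - 2"
    using d by linarith
  moreover have "card B \<le> card G"
    using B(1) G(1) by (rule card_mono[rotated])
  ultimately obtain H where H: "B \<subseteq> H" "H \<subseteq> G" "card H = min (card G) (2 * CARD('d) - 2)"
    using exists_subset_between[of B "min (card G) (2 * CARD('d) - 2)" G] B(1) G(1) by auto
  have "finite H"
    using H(2) G(1) finite_subset by blast
  have sep: "u = 0" if u: "\<And>g. g \<in> H \<Longrightarrow> cinner u g = 0" for u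
  proof -
    have "cinner u g = 0" if "g \<in> G" for g
      by (rule cinner_span_eq_0[of g B]) (use that B(3) H(1) u in blast)+
    then show ?thesis
      using does_PR_separating[OF G(2)] \<Theta>(1) by blast
  qed
  have "card (G - H) \<le> 1"
    using H \<open>finite H\<close> cardG by (simp add: card_Diff_subset)
  then have "\<forall>x\<in>G - H. \<forall>y\<in>G - H. x = y"
    using G(1) by (simp add: card_le_Suc0_iff_eq)
  then obtain g0 where g0: "G \<subseteq> insert g0 H"
    by blast
  obtain u v where uv: "u \<noteq> 0" "v \<noteq> 0" "\<And>g. g \<in> H \<Longrightarrow> cinner u g = 0 \<or> cinner v g = 0"
    using exists_orthogonal_pair[OF \<open>finite H\<close>] H(3) by (metis min.cobounded2)
  \<comment> \<open>These factors make the combination belonging to the phase \<open>c\<close>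
    orthogonal to \<open>g0\<close>. If \<open>u\<close> or \<open>v\<close> already is, the value 1
    keeps them nonzero.\<close>
  define p q where "p = (if cinner u g0 = 0 \<or> cinner v g0 = 0 then 1 else (a - c) * cinner v g0)"
    and "q = (if cinner u g0 = 0 \<or> cinner v g0 = 0 then 1 else (b - c) * cinner u g0)"
  have pq: "p \<noteq> 0" "q \<noteq> 0"
    using \<Theta>(5,6) by (auto simp: p_def q_def)
  define u' v' where "u' = p *s u" and "v' = q *s v"
  have nz: "u' \<noteq> 0" "v' \<noteq> 0"
    using pq uv(1,2) by (auto simp: u'_def v'_def)
  have H': "cinner u' g = 0 \<or> cinner v' g = 0" if "g \<in> H" for g
    using uv(3)[OF that] by (auto simp: u'_def v'_def cinner_scale_left)
  have g0': "cinner u' g0 = 0 \<or> cinner v' g0 = 0 \<or> cinner ((b - c) *s u' - (a - c) *s v') g0 = 0"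
    by (auto simp: u'_def v'_def p_def q_def cinner_scale_left cinner_diff_left)
  let ?f = "b *s u' - a *s v'" and ?h = "u' - v'"
  have "\<exists>\<theta>\<in>\<Theta>. cinner (?f - \<theta> *s ?h) g = 0" if "g \<in> G" for g
  proof -
    have "cinner u' g = 0 \<or> cinner v' g = 0 \<or> cinner ((b - c) *s u' - (a - c) *s v') g = 0"
      using that g0 g0' H' by blast
    then have "\<exists>\<theta>\<in>{a, b, c}. cinner (?f - \<theta> *s ?h) g = 0"
      unfolding pencil_combination by (auto simp: cinner_diff_left cinner_scale_left)
    then show ?thesis
      using \<Theta>(1-3) by blast
  qed
  then obtain t where "?f - t *s ?h = 0"
    by (rule does_PR_D[OF G(2)])
  then have dep: "(b - t) *s u' = (a - t) *s v'"
    unfolding pencil_combination by simp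
  then have "(b - t) * cinner u' g = (a - t) * cinner v' g" for g
    by (metis cinner_scale_left)
  \<comment> \<open>The two sides are equal and one of them vanishes, so both do. Hence
    \<open>(b - t) *s u'\<close> is orthogonal to the separating set \<open>H\<close>.\<close>
  then have *: "(b - t) * cinner u' g = 0 \<and> (a - t) * cinner v' g = 0" if "g \<in> H" for g
    using H'[OF that] by (metis mult_zero_right)
  show False
  proof (cases "b = t")
    case True
    then show False
      using dep nz(2) \<Theta>(4) by simp
  next
    case False
    then show False
      using * sep nz(1) by fastforce
  qed
qed

subsection \<open>The moment curve\<close>

text \<open>The conjugate cancels the one in \<open>cinner\<close>, which makes
  \<open>cinner w (moment t)\<close> a polynomial in \<open>t\<close>.\<close>

definition moment :: "complex \<Rightarrow> complex ^ 'd::finite" where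
  "moment t = (\<chi> i. cnj t ^ to_nat_on (UNIV :: 'd set) i)"

text \<open>The entries of \<open>w\<close> are the coefficients of a polynomial of degree at most
  \<open>CARD('d) - 1\<close>, since the indices are numbered from 0.\<close>

lemma cinner_moment_zeros:
  fixes w :: "complex ^ 'd"
  assumes "w \<noteq> 0"
  shows "finite {t. cinner w (moment t) = 0}"
    and "card {t. cinner w (moment t) = 0} \<le> CARD('d) - 1"
proof -
  let ?n = "to_nat_on (UNIV :: 'd set)"
  define P where "P = (\<Sum>i\<in>UNIV. monom (w $ i) (?n i))"
  have bij: "bij_betw ?n UNIV {..<CARD('d)}"
    by (simp add: to_nat_on_finite)
  have inj: "?n i = ?n j \<longleftrightarrow> i = j" for i j
    using bij by (auto simp: bij_betw_def inj_on_def)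
  have "coeff P (?n j) = w $ j" for j
    by (simp add: P_def coeff_sum inj)
  then have P0: "P \<noteq> 0"
    using assms by (metis coeff_0 vec_eq_iff zero_index)
  have le: "?n i \<le> CARD('d) - 1" for i
  proof -
    have "?n i < CARD('d)"
      using bij_betwE[OF bij] by blast
    then show ?thesis
      by linarith
  qed
  have "degree P \<le> CARD('d) - 1"
    unfolding P_def by (intro degree_sum_le order_trans[OF degree_monom_le le]) simp
  moreover have "{t. cinner w (moment t) = 0} = {t. poly P t = 0}"
    by (simp add: P_def poly_sum poly_monom cinner_def moment_def)
  ultimately show "finite {t. cinner w (moment t) = 0}"
      "card {t. cinner w (moment t) = 0} \<le> CARD('d) - 1"
    using poly_roots_finite[OF P0] card_poly_roots_bound[OF P0] by simp_all
qed

text \<open>Each \<open>w\<close> excludes only finitely many points of the moment curve, and the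
  curve has uncountably many parameters.\<close>

lemma exists_non_orthogonal:
  fixes W :: "(complex ^ 'd) set"
  assumes "countable W" "0 \<notin> W"
  obtains g where "\<And>w. w \<in> W \<Longrightarrow> cinner w g \<noteq> 0"
proof -
  have "countable {t. cinner w (moment t) = 0}" if "w \<in> W" for w
  proof (rule countable_finite, rule cinner_moment_zeros(1))
    show "w \<noteq> 0"
      using that assms(2) by blast
  qed
  then have "countable (\<Union>w\<in>W. {t. cinner w (moment t) = 0})"
    using assms(1) by (rule countable_UN[rotated])
  then have "(\<Union>w\<in>W. {t. cinner w (moment t) = 0}) \<noteq> UNIV"
    using uncountable_UNIV_complex by metis
  then obtain t where "\<And>w. w \<in> W \<Longrightarrow> cinner w (moment t) \<noteq> 0"
    by blast
  then show ?thesis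
    by (rule that)
qed

text \<open>If every \<open>f - \<theta> *s h\<close> is nonzero, each phase serves at most
  \<open>CARD('d) - 1\<close> parameters, so one parameter remains unserved.\<close>

lemma exists_does_PR_finite:
  assumes "finite \<Theta>"
  obtains G :: "(complex ^ 'd) set"
  where "finite G" "card G \<le> card \<Theta> * (CARD('d) - 1) + 1" "does_PR \<Theta> G"
proof -
  let ?N = "card \<Theta> * (CARD('d) - 1) + 1"
  let ?T = "of_nat ` {..<?N} :: complex set"
  let ?G = "moment ` ?T :: (complex ^ 'd) set"
  have cardT: "card ?T = ?N"
    by (subst card_image) (auto simp: inj_on_def)
  have "does_PR \<Theta> ?G"
    unfolding does_PR_def
  proof (intro allI impI, rule ccontr)
    fix f h :: "complex ^ 'd"
    assume fh: "\<forall>g\<in>?G. \<exists>\<theta>\<in>\<Theta>. cinner f g = \<theta> * cinner h g"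
      and "\<not> (\<exists>\<theta>\<in>\<Theta>. f = \<theta> *s h)"
    then have nz: "f - \<theta> *s h \<noteq> 0" if "\<theta> \<in> \<Theta>" for \<theta>
      using that by auto
    let ?Z = "\<lambda>\<theta>. {t. cinner (f - \<theta> *s h) (moment t) = 0}"
    have "?T \<subseteq> (\<Union>\<theta>\<in>\<Theta>. ?Z \<theta>)"
      using fh unfolding cinner_eq_iff by blast
    then have "card ?T \<le> card (\<Union>\<theta>\<in>\<Theta>. ?Z \<theta>)"
      using assms cinner_moment_zeros(1)[OF nz] by (intro card_mono finite_UN_I)
    also have "\<dots> \<le> (\<Sum>\<theta>\<in>\<Theta>. card (?Z \<theta>))"
      by (rule card_UN_le[OF assms])
    also have "\<dots> \<le> card \<Theta> * (CARD('d) - 1)"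
      using sum_bounded_above[of \<Theta> "\<lambda>\<theta>. card (?Z \<theta>)"] cinner_moment_zeros(2)[OF nz] by simp
    finally show False
      using cardT by simp
  qed
  moreover have "card ?G \<le> ?N"
    using card_image_le[of ?T moment] cardT by simp
  ultimately show ?thesis
    by (intro that[of ?G]) auto
qed

subsection \<open>Generic vectors for countable phase sets\<close>

text \<open>A pair \<open>(f, h)\<close> is encoded as a vector indexed by \<open>'d + 'd\<close>, so that subspaces of pairs
  have a complex dimension in the library's sense.\<close>

definition pencil :: "complex \<Rightarrow> complex ^ ('d + 'd) \<Rightarrow> complex ^ 'd::finite" where
  "pencil \<theta> x = (\<chi> i. x $ Inl i - \<theta> * x $ Inr i)"

definition pencil_sols :: "((complex ^ 'd) \<times> complex) list \<Rightarrow> (complex ^ ('d::finite + 'd)) set" where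
  "pencil_sols ps = {x. \<forall>(g, \<theta>)\<in>set ps. cinner (pencil \<theta> x) g = 0}"

lemma pencil_add: "pencil \<theta> (x + y) = pencil \<theta> x + pencil \<theta> y"
  by (simp add: pencil_def vec_eq_iff algebra_simps)

lemma pencil_scale: "pencil \<theta> (c *s x) = c *s pencil \<theta> x"
  by (simp add: pencil_def vec_eq_iff algebra_simps)

lemma pencil_zero [simp]: "pencil \<theta> 0 = 0"
  by (simp add: pencil_def vec_eq_iff)

lemma subspace_pencil_sols: "vec.subspace (pencil_sols ps)"
  unfolding vec.subspace_def pencil_sols_def
  by (auto simp: pencil_add pencil_scale cinner_add_left cinner_scale_left split: prod.splits)

lemma pencil_sols_Cons_subset: "pencil_sols (p # ps) \<subseteq> pencil_sols ps"
  by (auto simp: pencil_sols_def)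

text \<open>A subspace of full dimension would be everything, but \<open>x\<close> is lost.\<close>

lemma dim_pencil_sols_Cons:
  assumes "x \<in> pencil_sols ps" "cinner (pencil \<theta> x) g \<noteq> 0"
  shows "vec.dim (pencil_sols ((g, \<theta>) # ps)) < vec.dim (pencil_sols ps)"
proof (rule ccontr)
  assume "\<not> ?thesis"
  then have "pencil_sols ((g, \<theta>) # ps) = pencil_sols ps"
    by (intro vec.subspace_dim_equal subspace_pencil_sols pencil_sols_Cons_subset) simp
  with assms show False
    by (auto simp: pencil_sols_def)
qed

text \<open>Induction on \<open>n\<close>: one new vector must work for all old assignments and all
  next phases at once. These are countably many pairs, so \<open>exists_non_orthogonal\<close>
  applies.\<close>

lemma exists_generic_list:
  fixes \<Theta> :: "complex set"
  assumes "countable \<Theta>"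
  shows "\<exists>gs :: (complex ^ 'd) list. length gs = n \<and>
    (\<forall>\<sigma>s\<in>lists \<Theta>. length \<sigma>s = n \<longrightarrow>
      (\<exists>\<theta>\<in>\<Theta>. \<forall>x\<in>pencil_sols (zip gs \<sigma>s). pencil \<theta> x = 0) \<or>
      vec.dim (pencil_sols (zip gs \<sigma>s)) + n \<le> 2 * CARD('d))"
proof (induction n)
  case 0
  have "vec.dim (pencil_sols [] :: (complex ^ ('d + 'd)) set) \<le> CARD('d + 'd)"
    by (rule dim_subset_UNIV_cart_gen)
  then show ?case
    by simp
next
  case (Suc n)
  then obtain gs :: "(complex ^ 'd) list" where gs: "length gs = n"
    "\<And>\<sigma>s. \<sigma>s \<in> lists \<Theta> \<Longrightarrow> length \<sigma>s = n \<Longrightarrow>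
      (\<exists>\<theta>\<in>\<Theta>. \<forall>x\<in>pencil_sols (zip gs \<sigma>s). pencil \<theta> x = 0) \<or>
      vec.dim (pencil_sols (zip gs \<sigma>s)) + n \<le> 2 * CARD('d)"
    by blast
  \<comment> \<open>A solution violating the next phase, if there is one. Otherwise the value is
    arbitrary and harmless: \<open>g\<close> only has to avoid being orthogonal to the nonzero
    values.\<close>
  define w where "w = (\<lambda>(\<theta>, \<sigma>s). pencil \<theta> (SOME x. x \<in> pencil_sols (zip gs \<sigma>s) \<and> pencil \<theta> x \<noteq> 0))"
  have "countable (w ` (\<Theta> \<times> lists \<Theta>) - {0})"
    using assms by (intro countable_Diff countable_image countable_SIGMA countable_lists)
  then obtain g where g: "\<And>v. v \<in> w ` (\<Theta> \<times> lists \<Theta>) - {0} \<Longrightarrow> cinner v g \<noteq> 0"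
    using exists_non_orthogonal by (metis DiffD2 singletonI)
  have "(\<exists>\<theta>\<in>\<Theta>. \<forall>x\<in>pencil_sols (zip (g # gs) \<tau>s). pencil \<theta> x = 0) \<or>
      vec.dim (pencil_sols (zip (g # gs) \<tau>s)) + Suc n \<le> 2 * CARD('d)"
    if "\<tau>s \<in> lists \<Theta>" "length \<tau>s = Suc n" for \<tau>s
  proof -
    obtain \<theta> \<sigma>s where \<tau>s: "\<tau>s = \<theta> # \<sigma>s" "\<theta> \<in> \<Theta>" "\<sigma>s \<in> lists \<Theta>" "length \<sigma>s = n"
      using \<open>\<tau>s \<in> lists \<Theta>\<close> \<open>length \<tau>s = Suc n\<close> by (cases \<tau>s) auto
    let ?W = "pencil_sols (zip gs \<sigma>s)" and ?W' = "pencil_sols ((g, \<theta>) # zip gs \<sigma>s)"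
    show ?thesis
    proof (cases "\<exists>\<eta>\<in>\<Theta>. \<forall>x\<in>?W. pencil \<eta> x = 0")
      case True
      then show ?thesis
        using pencil_sols_Cons_subset[of "(g, \<theta>)" "zip gs \<sigma>s"] \<tau>s(1) by fastforce
    next
      case False
      then have dim: "vec.dim ?W + n \<le> 2 * CARD('d)"
        using gs(2) \<tau>s(3,4) by blast
      let ?x = "SOME x. x \<in> ?W \<and> pencil \<theta> x \<noteq> 0"
      have "\<exists>x. x \<in> ?W \<and> pencil \<theta> x \<noteq> 0"
        using False \<tau>s(2) by blast
      then have x: "?x \<in> ?W \<and> pencil \<theta> ?x \<noteq> 0"
        by (rule someI_ex)
      then have "w (\<theta>, \<sigma>s) \<in> w ` (\<Theta> \<times> lists \<Theta>) - {0}"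
        using \<tau>s(2,3) by (auto simp: w_def)
      then have "cinner (pencil \<theta> ?x) g \<noteq> 0"
        using g by (fastforce simp: w_def)
      then have "vec.dim ?W' < vec.dim ?W"
        using x dim_pencil_sols_Cons by blast
      then show ?thesis
        using dim \<tau>s(1) by simp
    qed
  qed
  then show ?case
    using gs(1) by (intro exI[of _ "g # gs"]) simp
qed

text \<open>After \<open>2 * CARD('d)\<close> generic vectors, every assignment either admits one
  common phase or has only the zero pair as a solution, for which any phase works.\<close>

lemma exists_does_PR_countable:
  assumes "countable \<Theta>" "\<Theta> \<noteq> {}"
  obtains G :: "(complex ^ 'd) set"
  where "finite G" "card G \<le> 2 * CARD('d)" "does_PR \<Theta> G"
proof -
  obtain gs :: "(complex ^ 'd) list" where gs: "length gs = 2 * CARD('d)"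
    "\<And>\<sigma>s. \<sigma>s \<in> lists \<Theta> \<Longrightarrow> length \<sigma>s = 2 * CARD('d) \<Longrightarrow>
      (\<exists>\<theta>\<in>\<Theta>. \<forall>x\<in>pencil_sols (zip gs \<sigma>s). pencil \<theta> x = 0) \<or>
      vec.dim (pencil_sols (zip gs \<sigma>s)) + 2 * CARD('d) \<le> 2 * CARD('d)"
    using exists_generic_list[OF assms(1), of "2 * CARD('d)"] by blast
  have "does_PR \<Theta> (set gs)"
    unfolding does_PR_def
  proof (intro allI impI)
    fix f h :: "complex ^ 'd"
    assume "\<forall>g\<in>set gs. \<exists>\<theta>\<in>\<Theta>. cinner f g = \<theta> * cinner h g"
    then obtain \<sigma> where \<sigma>: "\<And>g. g \<in> set gs \<Longrightarrow> \<sigma> g \<in> \<Theta> \<and> cinner f g = \<sigma> g * cinner h g"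
      by metis
    define x :: "complex ^ ('d + 'd)" where "x = (\<chi> i. case i of Inl j \<Rightarrow> f $ j | Inr j \<Rightarrow> h $ j)"
    have pencil_x: "pencil \<theta> x = f - \<theta> *s h" for \<theta>
      by (simp add: pencil_def x_def vec_eq_iff)
    let ?W = "pencil_sols (zip gs (map \<sigma> gs))"
    have xW: "x \<in> ?W"
      using \<sigma> by (auto simp: pencil_sols_def pencil_x cinner_eq_iff zip_map2 zip_same_conv_map)
    have "\<exists>\<theta>\<in>\<Theta>. pencil \<theta> x = 0"
    proof (cases "vec.dim ?W = 0")
      case True
      then have "x = 0"
        using xW vec.dim_eq_0 by blast
      then show ?thesis
        using assms(2) by auto
    next
      case False
      moreover have "map \<sigma> gs \<in> lists \<Theta>"
        using \<sigma> by auto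
      ultimately have "\<exists>\<theta>\<in>\<Theta>. \<forall>x\<in>?W. pencil \<theta> x = 0"
        using gs(2)[of "map \<sigma> gs"] gs(1) by (simp del: vec.dim_eq_0)
      then show ?thesis
        using xW by blast
    qed
    then show "\<exists>\<theta>\<in>\<Theta>. f = \<theta> *s h"
      by (simp add: pencil_x)
  qed
  then show ?thesis
    \<comment> \<open>Repetitions in \<open>gs\<close> are not excluded, so this is only an upper
      bound.\<close>
    using that[of "set gs"] card_length[of gs] gs(1) by simp
qed

section \<open>The value of the minimum in the three cases\<close>

lemma PR_number_eqI:
  fixes G :: "(complex ^ 'd) set"
  assumes "finite G" "card G \<le> n" "does_PR \<Theta> G"
    and ge: "\<And>G :: (complex ^ 'd) set. finite G \<Longrightarrow> does_PR \<Theta> G \<Longrightarrow> n \<le> card G"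
  shows "PR_number TYPE('d) \<Theta> = n"
proof -
  have "card G = n"
    using assms by (simp add: le_antisym)
  then have n: "n \<in> PR_sizes TYPE('d) \<Theta>"
    using assms(1,3) by (auto simp: PR_sizes_def)
  moreover have "(LEAST m. m \<in> PR_sizes TYPE('d) \<Theta>) = n"
    using n by (rule Least_equality) (auto simp: PR_sizes_def ge)
  ultimately show ?thesis
    by (auto simp: PR_number_def)
qed

theorem corollary1p10:
  fixes \<Theta> :: "complex set"
  assumes "CARD('d::finite) \<ge> 2"
    and "\<Theta> \<subseteq> {z. norm z = 1}"
    and "\<Theta> \<noteq> {}"
    and "countable \<Theta>"
  shows "PR_number TYPE('d) \<Theta> =
    (if card \<Theta> = 1 then CARD('d)
     else if card \<Theta> = 2 then 2 * CARD('d) - 1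
     else 2 * CARD('d))"
proof -
  consider (one) "card \<Theta> = 1" | (two) "card \<Theta> = 2" | (many) "card \<Theta> \<noteq> 1" "card \<Theta> \<noteq> 2"
    by blast
  then show ?thesis
  proof cases
    case one
    then have "finite \<Theta>"
      by (metis card.infinite zero_neq_one)
    then obtain G :: "(complex ^ 'd) set"
      where G: "finite G" "card G \<le> card \<Theta> * (CARD('d) - 1) + 1" "does_PR \<Theta> G"
      by (rule exists_does_PR_finite)
    have "card G \<le> CARD('d)"
      using G(2) one assms(1) by simp
    then have "PR_number TYPE('d) \<Theta> = CARD('d)"
      by (rule PR_number_eqI[OF G(1) _ G(3)]) (rule does_PR_card_ge[OF _ _ assms(3)])
    then show ?thesis
      using one by simp
  next
    case two
    then obtain a b where ab: "\<Theta> = {a, b}" "a \<noteq> b"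
      by (auto simp: card_2_iff)
    then have "finite \<Theta>"
      by simp
    then obtain G :: "(complex ^ 'd) set"
      where G: "finite G" "card G \<le> card \<Theta> * (CARD('d) - 1) + 1" "does_PR \<Theta> G"
      by (rule exists_does_PR_finite)
    have "card G \<le> 2 * CARD('d) - 1"
      using G(2) two assms(1) by simp
    then have "PR_number TYPE('d) \<Theta> = 2 * CARD('d) - 1"
      by (rule PR_number_eqI[OF G(1) _ G(3)]) (use ab does_PR_doubleton_card_ge in blast)
    then show ?thesis
      using two by simp
  next
    case many
    \<comment> \<open>An infinite \<open>\<Theta>\<close> has \<open>card \<Theta> = 0\<close> and
      so belongs to this case as well.\<close>
    have "\<exists>T\<subseteq>\<Theta>. card T = 3"
    proof (cases "finite \<Theta>")
      case True
      then have "card \<Theta> \<noteq> 0"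
        using assms(3) by simp
      then have "3 \<le> card \<Theta>"
        using many by linarith
      then show ?thesis
        by (metis obtain_subset_with_card_n)
    next
      case False
      then show ?thesis
        by (metis infinite_arbitrarily_large)
    qed
    then obtain a b c where abc: "a \<in> \<Theta>" "b \<in> \<Theta>" "c \<in> \<Theta>" "a \<noteq> b" "a \<noteq> c" "b \<noteq> c"
      by (auto simp: card_3_iff)
    obtain G :: "(complex ^ 'd) set"
      where G: "finite G" "card G \<le> 2 * CARD('d)" "does_PR \<Theta> G"
      using exists_does_PR_countable[OF assms(4,3)] by blast
    have "PR_number TYPE('d) \<Theta> = 2 * CARD('d)"
      by (rule PR_number_eqI[OF G]) (rule does_PR_three_card_ge[OF _ _ assms(1) abc])
    then show ?thesis
      using many by simp
  qed
qed

end
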